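(* Consider the system $$\dot x=f_0(x)+f_1(x)u,\qquad \dot u=\phi(x,u,t)+v,$$ with $x\in\mathbb{R}^n$, $u,v\in\mathbb{R}^m$, together with a control barrier function $h_x:\mathbb{R}^n\to\mathbb{R}$ and an integral control barrier function $h_u:\mathbb{R}^m\to\mathbb{R}$, with safe sets $\mathcal{S}_x=\{(x,u)\in\mathbb{R}^n\times\mathbb{R}^m : h_x(x)\ge 0\}$ and $\mathcal{S}_u=\{(x,u)\in\mathbb{R}^n\times\mathbb{R}^m: h_u(u)\ge0\}$ respectively. Let $h_e:\mathbb{R}^n\times\mathbb{R}^m\to\mathbb{R}$ be $h_e(x,u)=p_x(x)^\top u-d_x(x)$, and let $\mathcal{S}_e=\{(x,u)\in\mathbb{R}^n\times\mathbb{R}^m: h_e(x,u)\ge 0\}$. Suppose that the quadratic program $$v^*(x,u,t)=\operatorname*{argmin}_{v\in\mathbb{R}^m}\ \|v\|^2\quad\text{s.t.}\quad \begin{bmatrix}p_x(x)^\top\\ p_u(x,u)^\top\end{bmatrix}v\ \ge\ \begin{bmatrix}d_e(x,u,t)\\ d_u(x,u,t)\end{bmatrix}$$ (inequality componentwise) is feasible for every $(x,u)\in\mathbb{R}^n\times\mathbb{R}^m$ and $t\ge0$. Then the dynamically defined (integral) controller $\dot u=\phi(x,u,t)+v^*(x,u,t)$ renders $\mathcal{S}=\mathcal{S}_x\cap\mathcal{S}_u$ safe for appropriate initial conditions: if $x(0)=x_0$, $u(0)=u_0$ satisfy $h_x(x_0)\ge 0$ and $(x_0,u_0)\in\mathcal{S}_e\cap\mathcal{S}_u$,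 then $(x(t),u(t))\in\mathcal{S}_x\cap\mathcal{S}_u$ for all $t\ge0$.
   Context: Standing assumptions: $f_0:\mathbb{R}^n\to\mathbb{R}^n$, $f_1:\mathbb{R}^n\to\mathbb{R}^{n\times m}$ and $\phi:\mathbb{R}^n\times\mathbb{R}^m\times\mathbb{R}\to\mathbb{R}^m$ are continuously differentiable. $\gamma_x,\gamma_u,\gamma_e:\mathbb{R}\to\mathbb{R}$ are continuous extended class-$\mathcal{K}$ functions (monotone increasing, vanishing at $0$). $h_x$, $h_u$ are continuously differentiable with $0$ as a regular value, and $h_e$ is continuously differentiable. Notation for $h_x$: $p_x(x)^\top:=\frac{\partial h_x}{\partial x}(x)f_1(x)$ and $d_x(x):=-\big(\frac{\partial h_x}{\partial x}(x)f_0(x)+\gamma_x(h_x(x))\big)$. Then $h_e(x,u)=\dot h_x(x,u)+\gamma_x(h_x(x))$, where $\dot h_x(x,u)=\frac{\partial h_x}{\partial x}(x)(f_0(x)+f_1(x)u)$. $h_x$ is a control barrier function (CBF) for $\dot x=f_0(x)+f_1(x)u$ if for all $x$: $p_x(x)=0\Rightarrow d_x(x)\le0$. Notation for $h_u$: $p_u(x,u):=\big(\frac{\partial h_u}{\partial u}(u)\big)^\top$ and $d_u(x,u,t):=-\big(\frac{\partial h_u}{\partial u}(u)\phi(x,u,t)+\gamma_u(h_u(u))\big)$. $h_u$ is an integral control barrier function (I-CBF) if for all $(x,u)$ and $t\ge0$: $p_u(x,u)=0\Rightarrow d_u(x,u,t)\le0$. (The typical case is the input bound $h_u(u)=u_{\max}-u^\top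 u$ with $u_{\max}>0$.) Notation for $h_e$: $d_e(x,u,t):=-\big(\frac{\partial h_e}{\partial x}(x,u)(f_0(x)+f_1(x)u)+\frac{\partial h_e}{\partial u}(x,u)\phi(x,u,t)+\gamma_e(h_e(x,u))\big)$. Note $\big(\frac{\partial h_e}{\partial u}(x,u)\big)^\top=p_x(x)$. Convention: $(x(t),u(t))$ denotes any solution on $[0,\infty)$ of the closed-loop system $\dot x=f_0(x)+f_1(x)u$, $\dot u=\phi(x,u,t)+v^*(x,u,t)$ with the given initial condition. *)

theory Defs
  imports "HOL-Analysis.Analysis"
begin

definition continuously_differentiable ::
    "('a::real_normed_vector \<Rightarrow> 'b::real_normed_vector) \<Rightarrow> bool" where
  "continuously_differentiable f \<longleftrightarrow>
     (\<exists>f' :: 'a \<Rightarrow> 'a \<Rightarrow>\<^sub>L 'b.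
        (\<forall>x. (f has_derivative blinfun_apply (f' x)) (at x)) \<and> continuous_on UNIV f')"

definition regular_value ::
    "('a::real_normed_vector \<Rightarrow> 'b::real_normed_vector) \<Rightarrow> 'b \<Rightarrow> bool" where
  "regular_value f c \<longleftrightarrow> (\<forall>x. f x = c \<longrightarrow> surj (frechet_derivative f (at x)))"

definition extended_class_K :: "(real \<Rightarrow> real) \<Rightarrow> bool" where
  "extended_class_K \<gamma> \<longleftrightarrow> continuous_on UNIV \<gamma> \<and> strict_mono \<gamma> \<and> \<gamma> 0 = 0"

text \<open>The vector of partial derivatives. It stands for both the row vector \<open>\<partial>f/\<partial>x\<close> and its
  transpose; the product of the row vector with a column vector \<open>v\<close> is written
  \<open>gradient f x \<bullet> v\<close>, and its product with a matrix \<open>A\<close> is \<open>gradient f x v* A\<close>.\<close>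

definition gradient :: "(real^'n \<Rightarrow> real) \<Rightarrow> real^'n \<Rightarrow> real^'n" where
  "gradient f x = (\<chi> i. frechet_derivative f (at x) (axis i 1))"

lemma gradient_inner:
  fixes f :: "real^'n \<Rightarrow> real"
  assumes "f differentiable (at x)"
  shows "frechet_derivative f (at x) v = gradient f x \<bullet> v"
proof -
  have lin: "linear (frechet_derivative f (at x))"
    using assms by (rule linear_frechet_derivative)
  have "frechet_derivative f (at x) v = frechet_derivative f (at x) (\<Sum>i\<in>UNIV. v $ i *\<^sub>R axis i 1)"
    using basis_expansion[of v] by (simp add: scalar_mult_eq_scaleR)
  also have "\<dots> = (\<Sum>i\<in>UNIV. v $ i *\<^sub>R frechet_derivative f (at x) (axis i 1))"
    using lin by (simp add: linear_sum linear_cmul)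
  also have "\<dots> = gradient f x \<bullet> v"
    by (simp add: gradient_def inner_vec_def mult.commute)
  finally show ?thesis .
qed

definition p_x :: "(real^'n \<Rightarrow> real^'m^'n) \<Rightarrow> (real^'n \<Rightarrow> real) \<Rightarrow> real^'n \<Rightarrow> real^'m" where
  "p_x f\<^sub>1 h\<^sub>x x = gradient h\<^sub>x x v* f\<^sub>1 x"

definition d_x ::
    "(real^'n \<Rightarrow> real^'n) \<Rightarrow> (real \<Rightarrow> real) \<Rightarrow> (real^'n \<Rightarrow> real) \<Rightarrow> real^'n \<Rightarrow> real" where
  "d_x f\<^sub>0 \<gamma>\<^sub>x h\<^sub>x x = - (gradient h\<^sub>x x \<bullet> f\<^sub>0 x + \<gamma>\<^sub>x (h\<^sub>x x))"

definition control_barrier_function ::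
    "(real^'n \<Rightarrow> real^'n) \<Rightarrow> (real^'n \<Rightarrow> real^'m^'n) \<Rightarrow> (real \<Rightarrow> real) \<Rightarrow>
     (real^'n \<Rightarrow> real) \<Rightarrow> bool" where
  "control_barrier_function f\<^sub>0 f\<^sub>1 \<gamma>\<^sub>x h\<^sub>x \<longleftrightarrow>
     (\<forall>x. p_x f\<^sub>1 h\<^sub>x x = 0 \<longrightarrow> d_x f\<^sub>0 \<gamma>\<^sub>x h\<^sub>x x \<le> 0)"

definition p_u :: "(real^'m \<Rightarrow> real) \<Rightarrow> real^'n \<Rightarrow> real^'m \<Rightarrow> real^'m" where
  "p_u h\<^sub>u x u = gradient h\<^sub>u u"

definition d_u ::
    "(real^'n \<Rightarrow> real^'m \<Rightarrow> real \<Rightarrow> real^'m) \<Rightarrow> (real \<Rightarrow> real) \<Rightarrow> (real^'m \<Rightarrow> real) \<Rightarrow>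
     real^'n \<Rightarrow> real^'m \<Rightarrow> real \<Rightarrow> real" where
  "d_u \<phi> \<gamma>\<^sub>u h\<^sub>u x u t = - (gradient h\<^sub>u u \<bullet> \<phi> x u t + \<gamma>\<^sub>u (h\<^sub>u u))"

definition integral_control_barrier_function ::
    "(real^'n \<Rightarrow> real^'m \<Rightarrow> real \<Rightarrow> real^'m) \<Rightarrow> (real \<Rightarrow> real) \<Rightarrow> (real^'m \<Rightarrow> real) \<Rightarrow> bool" where
  "integral_control_barrier_function \<phi> \<gamma>\<^sub>u h\<^sub>u \<longleftrightarrow>
     (\<forall>x u t. t \<ge> 0 \<longrightarrow> p_u h\<^sub>u x u = 0 \<longrightarrow> d_u \<phi> \<gamma>\<^sub>u h\<^sub>u x u t \<le> 0)"

definition d_e ::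
    "(real^'n \<Rightarrow> real^'n) \<Rightarrow> (real^'n \<Rightarrow> real^'m^'n) \<Rightarrow>
     (real^'n \<Rightarrow> real^'m \<Rightarrow> real \<Rightarrow> real^'m) \<Rightarrow> (real \<Rightarrow> real) \<Rightarrow>
     (real^'n \<Rightarrow> real^'m \<Rightarrow> real) \<Rightarrow> real^'n \<Rightarrow> real^'m \<Rightarrow> real \<Rightarrow> real" where
  "d_e f\<^sub>0 f\<^sub>1 \<phi> \<gamma>\<^sub>e h\<^sub>e x u t =
     - (gradient (\<lambda>x'. h\<^sub>e x' u) x \<bullet> (f\<^sub>0 x + f\<^sub>1 x *v u)
        + gradient (\<lambda>u'. h\<^sub>e x u') u \<bullet> \<phi> x u t + \<gamma>\<^sub>e (h\<^sub>e x u))"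

definition safe_x :: "(real^'n \<Rightarrow> real) \<Rightarrow> ((real^'n) \<times> (real^'m)) set" where
  "safe_x h\<^sub>x = {(x, u). h\<^sub>x x \<ge> 0}"

definition safe_u :: "(real^'m \<Rightarrow> real) \<Rightarrow> ((real^'n) \<times> (real^'m)) set" where
  "safe_u h\<^sub>u = {(x, u). h\<^sub>u u \<ge> 0}"

definition safe_e :: "(real^'n \<Rightarrow> real^'m \<Rightarrow> real) \<Rightarrow> ((real^'n) \<times> (real^'m)) set" where
  "safe_e h\<^sub>e = {(x, u). h\<^sub>e x u \<ge> 0}"

definition qp_constraints ::
    "(real^'n \<Rightarrow> real^'n) \<Rightarrow> (real^'n \<Rightarrow> real^'m^'n) \<Rightarrow>
     (real^'n \<Rightarrow> real^'m \<Rightarrow> real \<Rightarrow> real^'m) \<Rightarrow>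
     (real \<Rightarrow> real) \<Rightarrow> (real \<Rightarrow> real) \<Rightarrow>
     (real^'n \<Rightarrow> real) \<Rightarrow> (real^'m \<Rightarrow> real) \<Rightarrow> (real^'n \<Rightarrow> real^'m \<Rightarrow> real) \<Rightarrow>
     real^'n \<Rightarrow> real^'m \<Rightarrow> real \<Rightarrow> (real^'m) set" where
  "qp_constraints f\<^sub>0 f\<^sub>1 \<phi> \<gamma>\<^sub>u \<gamma>\<^sub>e h\<^sub>x h\<^sub>u h\<^sub>e x u t =
     {v. p_x f\<^sub>1 h\<^sub>x x \<bullet> v \<ge> d_e f\<^sub>0 f\<^sub>1 \<phi> \<gamma>\<^sub>e h\<^sub>e x u t \<and>
         p_u h\<^sub>u x u \<bullet> v \<ge> d_u \<phi> \<gamma>\<^sub>u h\<^sub>u x u t}"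

text \<open>Whenever the constraint set is nonempty, the minimizer exists and is unique, since the set is
  closed and convex; so the choice made by \<open>arg_min\<close> is immaterial there.\<close>

definition qp_solution ::
    "(real^'n \<Rightarrow> real^'n) \<Rightarrow> (real^'n \<Rightarrow> real^'m^'n) \<Rightarrow>
     (real^'n \<Rightarrow> real^'m \<Rightarrow> real \<Rightarrow> real^'m) \<Rightarrow>
     (real \<Rightarrow> real) \<Rightarrow> (real \<Rightarrow> real) \<Rightarrow>
     (real^'n \<Rightarrow> real) \<Rightarrow> (real^'m \<Rightarrow> real) \<Rightarrow> (real^'n \<Rightarrow> real^'m \<Rightarrow> real) \<Rightarrow>
     real^'n \<Rightarrow> real^'m \<Rightarrow> real \<Rightarrow> real^'m" where
  "qp_solution f\<^sub>0 f\<^sub>1 \<phi> \<gamma>\<^sub>u \<gamma>\<^sub>e h\<^sub>x h\<^sub>u h\<^sub>e x u t =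
     arg_min (\<lambda>v. (norm v)\<^sup>2) (\<lambda>v. v \<in> qp_constraints f\<^sub>0 f\<^sub>1 \<phi> \<gamma>\<^sub>u \<gamma>\<^sub>e h\<^sub>x h\<^sub>u h\<^sub>e x u t)"

text \<open>Classical solutions on \<open>[0, \<infinity>)\<close>, with a one-sided derivative at time \<open>0\<close>. No continuity of the
  feedback \<open>k\<close> is presupposed, hence none of the derivatives of \<open>x\<close> and \<open>u\<close> either.\<close>

definition closed_loop_solution ::
    "(real^'n \<Rightarrow> real^'n) \<Rightarrow> (real^'n \<Rightarrow> real^'m^'n) \<Rightarrow>
     (real^'n \<Rightarrow> real^'m \<Rightarrow> real \<Rightarrow> real^'m) \<Rightarrow> (real^'n \<Rightarrow> real^'m \<Rightarrow> real \<Rightarrow> real^'m) \<Rightarrow>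
     (real \<Rightarrow> real^'n) \<Rightarrow> (real \<Rightarrow> real^'m) \<Rightarrow> bool" where
  "closed_loop_solution f\<^sub>0 f\<^sub>1 \<phi> k x u \<longleftrightarrow>
     (\<forall>t\<ge>0.
        (x has_vector_derivative f\<^sub>0 (x t) + f\<^sub>1 (x t) *v u t) (at t within {0..}) \<and>
        (u has_vector_derivative \<phi> (x t) (u t) t + k (x t) (u t) t) (at t within {0..}))"

end

theory Submission
  imports Defs
begin

text \<open>A feasible point of the quadratic program is exactly a correction \<open>v\<close> that turns the rates of
  change of \<open>h\<^sub>e\<close> and \<open>h\<^sub>u\<close> along the closed loop into barrier inequalities \<open>y' \<ge> - \<gamma> y\<close>, and a
  minimizer over a nonempty closed set exists, so the controller is feasible at every time
  (lemma \<open>qp_solution_feasible\<close>). A quantity that satisfies a barrier inequality and starts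
  nonnegative stays nonnegative (lemma \<open>barrier_invariance\<close>), which gives \<open>h\<^sub>u \<ge> 0\<close> and
  \<open>h\<^sub>e \<ge> 0\<close> along the solution. As \<open>h\<^sub>e\<close> is the rate of change of \<open>h\<^sub>x\<close> plus \<open>\<gamma>\<^sub>x h\<^sub>x\<close>, the inequality
  \<open>h\<^sub>e \<ge> 0\<close> is itself a barrier inequality for \<open>h\<^sub>x\<close>, and a third use of the invariance lemma gives
  \<open>h\<^sub>x \<ge> 0\<close>.

  Solutions may have discontinuous derivatives, and \<open>\<gamma>\<close> need not be Lipschitz. The invariance
  argument therefore uses neither integration nor a comparison with the solutions of \<open>z' = - \<gamma> z\<close>,
  but only the mean value theorem and the sign of \<open>\<gamma>\<close>.\<close>

text \<open>After the last time at which \<open>y\<close> was nonnegative, \<open>y\<close> would be negative, hence nondecreasing, and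
  so could never have dropped below the value it had at that time.\<close>

lemma nonneg_if_deriv_nonneg_where_negative:
  fixes y y' :: "real \<Rightarrow> real"
  assumes deriv: "\<And>t. t \<ge> 0 \<Longrightarrow> (y has_real_derivative y' t) (at t within {0..})"
    and push: "\<And>t. t \<ge> 0 \<Longrightarrow> y t < 0 \<Longrightarrow> y' t \<ge> 0"
    and init: "y 0 \<ge> 0" and "T \<ge> 0"
  shows "y T \<ge> 0"
proof (rule ccontr)
  assume neg: "\<not> y T \<ge> 0"
  define N where "N = {t \<in> {0..T}. 0 \<le> y t}"
  have "continuous_on {0..} y"
    using deriv DERIV_continuous continuous_on_eq_continuous_within by (metis atLeast_iff)
  then have "continuous_on {0..T} y"
    by (rule continuous_on_subset) auto
  then have "closed N"
    using continuous_closed_preimage[of "{0..T}" y "{0..}"] by (simp add: N_def vimage_def Int_def)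
  moreover have "N \<subseteq> {0..T}"
    by (auto simp: N_def)
  ultimately have "compact N"
    by (metis bounded_closed_interval bounded_subset compact_eq_bounded_closed)
  moreover have "N \<noteq> {}" using init \<open>T \<ge> 0\<close> by (auto simp: N_def)
  ultimately obtain s where s: "s \<in> N" and last: "\<And>t. t \<in> N \<Longrightarrow> t \<le> s"
    by (meson compact_attains_sup)
  have "0 \<le> s" "s < T" using s neg by (auto simp: N_def order.order_iff_strict)
  have "(y has_derivative (*) (y' t)) (at t within {s..T})" if "s \<le> t" "t \<le> T" for t
    using deriv[of t] that \<open>0 \<le> s\<close>
    by (auto simp: has_field_derivative_def intro: has_derivative_subset)
  then obtain t where t: "t \<in> {s<..<T}" "y T - y s = y' t * (T - s)"
    using mvt_simple[OF \<open>s < T\<close>, of y "\<lambda>t. (*) (y' t)"] by auto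
  have "y t < 0" using last[of t] t(1) \<open>0 \<le> s\<close> by (force simp: N_def)
  then have "y' t \<ge> 0" using push t(1) \<open>0 \<le> s\<close> by auto
  then have "y T \<ge> y s" using t(2) \<open>s < T\<close> by (metis diff_ge_0_iff_ge less_imp_le mult_nonneg_nonneg)
  then show False using s neg by (auto simp: N_def)
qed

lemma barrier_invariance:
  fixes y y' :: "real \<Rightarrow> real"
  assumes "extended_class_K \<gamma>"
    and "\<And>t. t \<ge> 0 \<Longrightarrow> (y has_real_derivative y' t) (at t within {0..})"
    and barrier: "\<And>t. t \<ge> 0 \<Longrightarrow> y' t \<ge> - \<gamma> (y t)"
    and "y 0 \<ge> 0" and "T \<ge> 0"
  shows "y T \<ge> 0"
proof (rule nonneg_if_deriv_nonneg_where_negative[OF assms(2) _ assms(4,5)])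
  fix t :: real assume "t \<ge> 0" "y t < 0"
  then have "\<gamma> (y t) < 0"
    using assms(1) by (metis extended_class_K_def strict_monoD)
  then show "y' t \<ge> 0" using barrier[OF \<open>t \<ge> 0\<close>] by simp
qed

lemma continuously_differentiable_imp_differentiable:
  "continuously_differentiable f \<Longrightarrow> f differentiable (at x)"
  by (auto simp: continuously_differentiable_def differentiable_def)

lemma gradient_eqI:
  fixes f :: "real^'n \<Rightarrow> real"
  assumes "(f has_derivative D) (at x)"
  shows "gradient f x \<bullet> v = D v"
  using assms gradient_inner[of f x v] frechet_derivative_at[OF assms] differentiableI[OF assms]
  by metis

lemma has_real_derivative_along_curve:
  fixes f :: "real^'n \<Rightarrow> real"
  assumes "f differentiable (at (c t))"
    and "(c has_vector_derivative c') (at t within S)"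
  shows "((\<lambda>s. f (c s)) has_real_derivative gradient f (c t) \<bullet> c') (at t within S)"
proof -
  have "(f has_derivative frechet_derivative f (at (c t))) (at (c t))"
    using assms(1) by (simp add: frechet_derivative_works)
  then have "((\<lambda>s. f (c s)) has_vector_derivative frechet_derivative f (at (c t)) c') (at t within S)"
    using vector_derivative_diff_chain_within[OF assms(2)] has_derivative_at_withinI
    by (force simp: o_def)
  then show ?thesis
    by (simp add: gradient_inner[OF assms(1)] has_real_derivative_iff_has_vector_derivative)
qed

text \<open>The derivative of a function of two vectors is the sum of its two partial derivatives, because
  a direction \<open>(a, b)\<close> splits as \<open>(a, 0) + (0, b)\<close>.\<close>

lemma has_real_derivative_along_pair:
  fixes f :: "real^'n \<Rightarrow> real^'m \<Rightarrow> real"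
  assumes f: "(\<lambda>(x, u). f x u) differentiable (at (x t, u t))"
    and x: "(x has_vector_derivative x') (at t within S)"
    and u: "(u has_vector_derivative u') (at t within S)"
  shows "((\<lambda>s. f (x s) (u s)) has_real_derivative
            gradient (\<lambda>a. f a (u t)) (x t) \<bullet> x' + gradient (\<lambda>b. f (x t) b) (u t) \<bullet> u')
          (at t within S)"
proof -
  obtain D where D: "((\<lambda>(x, u). f x u) has_derivative D) (at (x t, u t))"
    using f by (auto simp: differentiable_def)
  have "((\<lambda>a. (a, u t)) has_derivative (\<lambda>a. (a, 0))) (at (x t))"
    "((\<lambda>b. (x t, b)) has_derivative (\<lambda>b. (0, b))) (at (u t))"
    by (auto intro!: derivative_eq_intros)
  from this[THEN diff_chain_at, OF D]
  have "((\<lambda>a. f a (u t)) has_derivative (\<lambda>a. D (a, 0))) (at (x t))"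
    "((\<lambda>b. f (x t) b) has_derivative (\<lambda>b. D (0, b))) (at (u t))"
    by (auto simp: o_def)
  then have "gradient (\<lambda>a. f a (u t)) (x t) \<bullet> x' + gradient (\<lambda>b. f (x t) b) (u t) \<bullet> u'
      = D (x', 0) + D (0, u')"
    by (simp add: gradient_eqI)
  also have "\<dots> = D (x', u')"
    using linear_add[OF has_derivative_linear[OF D], of "(x', 0)" "(0, u')"] by simp
  finally have D_eq: "gradient (\<lambda>a. f a (u t)) (x t) \<bullet> x' + gradient (\<lambda>b. f (x t) b) (u t) \<bullet> u'
      = D (x', u')" .
  have "((\<lambda>s. (x s, u s)) has_vector_derivative (x', u')) (at t within S)"
    using x u by (rule has_vector_derivative_Pair)
  from vector_derivative_diff_chain_within[OF this has_derivative_at_withinI[OF D]]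
  show ?thesis
    by (simp add: D_eq o_def has_real_derivative_iff_has_vector_derivative)
qed

text \<open>The feasible set is an intersection of two closed half-spaces, and a minimizer of the norm is a
  point of it nearest to the origin.\<close>

lemma qp_solution_feasible:
  assumes "qp_constraints f\<^sub>0 f\<^sub>1 \<phi> \<gamma>\<^sub>u \<gamma>\<^sub>e h\<^sub>x h\<^sub>u h\<^sub>e x u t \<noteq> {}"
  shows "qp_solution f\<^sub>0 f\<^sub>1 \<phi> \<gamma>\<^sub>u \<gamma>\<^sub>e h\<^sub>x h\<^sub>u h\<^sub>e x u t
           \<in> qp_constraints f\<^sub>0 f\<^sub>1 \<phi> \<gamma>\<^sub>u \<gamma>\<^sub>e h\<^sub>x h\<^sub>u h\<^sub>e x u t"
proof -
  let ?C = "qp_constraints f\<^sub>0 f\<^sub>1 \<phi> \<gamma>\<^sub>u \<gamma>\<^sub>e h\<^sub>x h\<^sub>u h\<^sub>e x u t"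
  have "closed ?C"
    unfolding qp_constraints_def by (intro closed_Collect_conj closed_Collect_le continuous_intros)
  then obtain w where w: "w \<in> ?C" "\<And>v. v \<in> ?C \<Longrightarrow> norm w \<le> norm v"
    using distance_attains_inf[of ?C 0] assms by auto
  then have "is_arg_min (\<lambda>v. (norm v)\<^sup>2) (\<lambda>v. v \<in> ?C) w"
    by (auto simp: is_arg_min_linorder intro: power_mono)
  then have "is_arg_min (\<lambda>v. (norm v)\<^sup>2) (\<lambda>v. v \<in> ?C) (arg_min (\<lambda>v. (norm v)\<^sup>2) (\<lambda>v. v \<in> ?C))"
    unfolding arg_min_def by (rule someI)
  then show ?thesis
    by (simp add: is_arg_min_def qp_solution_def)
qed

theorem theorem2:
  fixes f\<^sub>0 :: "real^'n \<Rightarrow> real^'n"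
    and f\<^sub>1 :: "real^'n \<Rightarrow> real^'m^'n"
    and \<phi> :: "real^'n \<Rightarrow> real^'m \<Rightarrow> real \<Rightarrow> real^'m"
    and \<gamma>\<^sub>x \<gamma>\<^sub>u \<gamma>\<^sub>e :: "real \<Rightarrow> real"
    and h\<^sub>x :: "real^'n \<Rightarrow> real"
    and h\<^sub>u :: "real^'m \<Rightarrow> real"
    and h\<^sub>e :: "real^'n \<Rightarrow> real^'m \<Rightarrow> real"
    and v_star :: "real^'n \<Rightarrow> real^'m \<Rightarrow> real \<Rightarrow> real^'m"
    and x :: "real \<Rightarrow> real^'n" and u :: "real \<Rightarrow> real^'m"
    and x\<^sub>0 :: "real^'n" and u\<^sub>0 :: "real^'m"
  assumes "continuously_differentiable f\<^sub>0"
    and "continuously_differentiable f\<^sub>1"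
    and "continuously_differentiable (\<lambda>(x, u, t). \<phi> x u t)"
    and "extended_class_K \<gamma>\<^sub>x" and "extended_class_K \<gamma>\<^sub>u" and "extended_class_K \<gamma>\<^sub>e"
    and "continuously_differentiable h\<^sub>x" and "regular_value h\<^sub>x 0"
    and "continuously_differentiable h\<^sub>u" and "regular_value h\<^sub>u 0"
    and "control_barrier_function f\<^sub>0 f\<^sub>1 \<gamma>\<^sub>x h\<^sub>x"
    and "integral_control_barrier_function \<phi> \<gamma>\<^sub>u h\<^sub>u"
    and "\<And>x u. h\<^sub>e x u = p_x f\<^sub>1 h\<^sub>x x \<bullet> u - d_x f\<^sub>0 \<gamma>\<^sub>x h\<^sub>x x"
    and "continuously_differentiable (\<lambda>(x, u). h\<^sub>e x u)"
    and "\<And>x u t. t \<ge> 0 \<Longrightarrow> qp_constraints f\<^sub>0 f\<^sub>1 \<phi> \<gamma>\<^sub>u \<gamma>\<^sub>e h\<^sub>x h\<^sub>u h\<^sub>e x u t \<noteq> {}"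
    and "\<And>x u t. t \<ge> 0 \<Longrightarrow>
           v_star x u t = qp_solution f\<^sub>0 f\<^sub>1 \<phi> \<gamma>\<^sub>u \<gamma>\<^sub>e h\<^sub>x h\<^sub>u h\<^sub>e x u t"
    and "closed_loop_solution f\<^sub>0 f\<^sub>1 \<phi> v_star x u"
    and "x 0 = x\<^sub>0" and "u 0 = u\<^sub>0"
    and "h\<^sub>x x\<^sub>0 \<ge> 0" and "(x\<^sub>0, u\<^sub>0) \<in> safe_e h\<^sub>e \<inter> safe_u h\<^sub>u"
  shows "\<forall>t\<ge>0. (x t, u t) \<in> safe_x h\<^sub>x \<inter> safe_u h\<^sub>u"
proof -
  let ?x' = "\<lambda>t. f\<^sub>0 (x t) + f\<^sub>1 (x t) *v u t"
  let ?v = "\<lambda>t. v_star (x t) (u t) t"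
  let ?u' = "\<lambda>t. \<phi> (x t) (u t) t + ?v t"
  note he = assms(13)
  have x: "(x has_vector_derivative ?x' t) (at t within {0..})"
    and u: "(u has_vector_derivative ?u' t) (at t within {0..})" if "t \<ge> 0" for t
    using assms(17) that by (auto simp: closed_loop_solution_def)
  have feasible: "p_x f\<^sub>1 h\<^sub>x (x t) \<bullet> ?v t \<ge> d_e f\<^sub>0 f\<^sub>1 \<phi> \<gamma>\<^sub>e h\<^sub>e (x t) (u t) t"
    "p_u h\<^sub>u (x t) (u t) \<bullet> ?v t \<ge> d_u \<phi> \<gamma>\<^sub>u h\<^sub>u (x t) (u t) t" if "t \<ge> 0" for t
    using qp_solution_feasible[OF assms(15)[OF that]] assms(16)[OF that]
    by (auto simp: qp_constraints_def)
  have init: "h\<^sub>x (x 0) \<ge> 0" "h\<^sub>e (x 0) (u 0) \<ge> 0" "h\<^sub>u (u 0) \<ge> 0"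
    using assms(18-21) by (auto simp: safe_e_def safe_u_def)
  have grad_he: "gradient (\<lambda>b. h\<^sub>e a b) b \<bullet> w = p_x f\<^sub>1 h\<^sub>x a \<bullet> w" for a b w
    by (rule gradient_eqI) (auto simp: he intro!: derivative_eq_intros)

  have hu: "h\<^sub>u (u t) \<ge> 0" if "t \<ge> 0" for t
  proof (rule barrier_invariance[where y = "\<lambda>t. h\<^sub>u (u t)", OF assms(5) _ _ init(3) that])
    fix t :: real assume t: "t \<ge> 0"
    show "((\<lambda>t. h\<^sub>u (u t)) has_real_derivative gradient h\<^sub>u (u t) \<bullet> ?u' t) (at t within {0..})"
      by (intro has_real_derivative_along_curve u t
          continuously_differentiable_imp_differentiable assms(9))
    show "gradient h\<^sub>u (u t) \<bullet> ?u' t \<ge> - \<gamma>\<^sub>u (h\<^sub>u (u t))"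
      using feasible(2)[OF t] by (simp add: p_u_def d_u_def inner_add_right)
  qed

  have he_nonneg: "h\<^sub>e (x t) (u t) \<ge> 0" if "t \<ge> 0" for t
  proof (rule barrier_invariance[where y = "\<lambda>t. h\<^sub>e (x t) (u t)", OF assms(6) _ _ init(2) that])
    fix t :: real assume t: "t \<ge> 0"
    let ?D = "gradient (\<lambda>a. h\<^sub>e a (u t)) (x t) \<bullet> ?x' t + gradient (\<lambda>b. h\<^sub>e (x t) b) (u t) \<bullet> ?u' t"
    show "((\<lambda>t. h\<^sub>e (x t) (u t)) has_real_derivative ?D) (at t within {0..})"
      by (intro has_real_derivative_along_pair x u t
          continuously_differentiable_imp_differentiable assms(14))
    \<comment> \<open>The input \<open>v\<close> enters the rate of \<open>h\<^sub>e\<close> through \<open>\<partial>h\<^sub>e/\<partial>u = p\<^sub>x\<close>, as the first constraint expects.\<close>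
    show "?D \<ge> - \<gamma>\<^sub>e (h\<^sub>e (x t) (u t))"
      using feasible(1)[OF t] by (simp add: d_e_def grad_he inner_add_right)
  qed

  have hx: "h\<^sub>x (x t) \<ge> 0" if "t \<ge> 0" for t
  proof (rule barrier_invariance[where y = "\<lambda>t. h\<^sub>x (x t)", OF assms(4) _ _ init(1) that])
    fix t :: real assume t: "t \<ge> 0"
    show "((\<lambda>t. h\<^sub>x (x t)) has_real_derivative gradient h\<^sub>x (x t) \<bullet> ?x' t) (at t within {0..})"
      by (intro has_real_derivative_along_curve x t
          continuously_differentiable_imp_differentiable assms(7))
    show "gradient h\<^sub>x (x t) \<bullet> ?x' t \<ge> - \<gamma>\<^sub>x (h\<^sub>x (x t))"
      using he_nonneg[OF t] by (simp add: he p_x_def d_x_def dot_lmul_matrix inner_add_right)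
  qed

  show ?thesis using hx hu by (auto simp: safe_x_def safe_u_def)
qed

end
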